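(* Let $(\xi_{n,m})_{n,m\in\mathbb{Z}}$ be a strictly stationary real-valued random field on the canonical space $\mathbb{R}^{\mathbb{Z}^2}$, with filtration $\mathcal{F}_{n,m}=\sigma(\xi_{i,j}: i\le n, j\le m)$, and let $X_{n,m}=f(\xi_{i,j}, i\le n, j\le m)$ be the associated stationary random field, with $X_{0,0}$ centered and square integrable. Assume that the filtration is commuting, i.e. for every integrable random variable $X$ and all integers $a,b,u,v$ with $a\ge u$, $E(E(X|\mathcal{F}_{a,b})|\mathcal{F}_{u,v})=E(X|\mathcal{F}_{u,b\wedge v})$ almost surely. Let $S_{n,m}=\sum_{u=1}^n\sum_{v=1}^m X_{u,v}$. Then $(X_{n,m})_{n,m\in\mathbb{Z}}$ admits a martingale approximation if and only if there is a square integrable random variable $D_{1,1}$ such that $$\frac{1}{nm}\sum_{j=1}^{n}\sum_{k=1}^{m}\mathcal{P}_{1,1}(S_{j,k})\ \text{ converges in } L^{2}\text{ to } D_{1,1}\text{ as } n\wedge m\to\infty$$ and $$\frac{1}{nm}\|S_{n,m}\|^{2}\to\|D_{1,1}\|^{2}\quad\text{as } n\wedge m\to\infty.$$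
   Context: Notation: $a\wedge b=\min(a,b)$; $\|\cdot\|$ is the $L^2$ norm; a limit as $n\wedge m\to\infty$ is a limit as $\min(n,m)\to\infty$ with $n,m$ otherwise unrestricted. Setting: $(\xi_{\mathbf u})_{\mathbf u\in\mathbb{Z}^2}$ is a strictly stationary real-valued random field realized as the coordinate maps on $\Omega=\mathbb{R}^{\mathbb{Z}^2}$, with the $\sigma$-field generated by cylinders and a shift-invariant probability measure $P$. For a measurable function $g$, the notation $Y_{n,m}=g(\xi_{i,j}, i\le n, j\le m)$ means $Y_{n,m}=g\big((\xi_{n+a,m+b})_{a\le 0,b\le 0}\big)$, the same $g$ being used for all $(n,m)$, so that $(Y_{n,m})$ is obtained from $Y_{0,0}$ by shifting: $Y_{n,m}=Y_{0,0}\circ T^nS^m$, where $T((x_{u,v}))=(x_{u+1,v})$ and $S((x_{u,v}))=(x_{u,v+1})$. The field is $X_{n,m}=f(\xi_{i,j}, i\le n, j\le m)$ with $f$ measurable, $E(X_{0,0})=0$, $E(X_{0,0}^2)<\infty$. Write $E_{a,b}(X)=E(X|\mathcal{F}_{a,b})$. The projection operator is $$\mathcal{P}_{u,v}(X)=E_{u,v}(X)-E_{u,v-1}(X)-E_{u-1,v}(X)+E_{u-1,v-1}(X).$$ Martingale differences field: a field $D_{n,m}=d(\xi_{i,j}, i\le n, j\le m)$, with $d$ a measurable function and $D_{n,m}$ integrable, such that $E_{a,b}(D_{n,m})=0$ whenever $a<n$ or $b<m$. Martingale approximation: $(X_{n,m})$ admits a martingale approximation if there is a martingale differences field $(D_{n,m})$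 such that, with $M_{n,m}=\sum_{u=1}^n\sum_{v=1}^m D_{u,v}$, $\lim_{n\wedge m\to\infty}\frac{1}{nm}\|S_{n,m}-M_{n,m}\|^2=0$. *)

theory Defs
  imports "HOL-Probability.Probability"
begin

definition config_space :: "(int \<times> int \<Rightarrow> real) measure" where
  "config_space = PiM UNIV (\<lambda>_. borel)"

definition shiftT :: "(int \<times> int \<Rightarrow> real) \<Rightarrow> int \<times> int \<Rightarrow> real" where
  "shiftT x = (\<lambda>(u, v). x (u + 1, v))"

definition shiftS :: "(int \<times> int \<Rightarrow> real) \<Rightarrow> int \<times> int \<Rightarrow> real" where
  "shiftS x = (\<lambda>(u, v). x (u, v + 1))"

text \<open>The law of a strictly stationary field, realised by the coordinate maps
  \<open>\<xi>\<^sub>u\<^sub>,\<^sub>v x = x (u, v)\<close>.  Invariance under the two unit shifts gives invariance under all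
  shifts, since both are invertible.\<close>

definition stationary_law :: "(int \<times> int \<Rightarrow> real) measure \<Rightarrow> bool" where
  "stationary_law P \<longleftrightarrow> prob_space P \<and> sets P = sets config_space \<and>
     distr P P shiftT = P \<and> distr P P shiftS = P"

definition filtr :: "int \<Rightarrow> int \<Rightarrow> (int \<times> int \<Rightarrow> real) measure" where
  "filtr n m = sigma UNIV
     {(\<lambda>x. x (i, j)) -` B | i j B. i \<le> n \<and> j \<le> m \<and> B \<in> sets borel}"

definition quadrant :: "(int \<times> int) set" where
  "quadrant = {..0} \<times> {..0}"

definition past_functionals :: "((int \<times> int \<Rightarrow> real) \<Rightarrow> real) set" where
  "past_functionals = borel_measurable (PiM quadrant (\<lambda>_. borel))"

text \<open>\<open>g(\<xi>\<^sub>i\<^sub>,\<^sub>j, i \<le> n, j \<le> m)\<close>: the past seen from \<open>(n, m)\<close>, re-indexed by \<open>quadrant\<close>, is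
  handed to one and the same \<open>g\<close> for all \<open>(n, m)\<close>.\<close>

definition field_of ::
    "((int \<times> int \<Rightarrow> real) \<Rightarrow> real) \<Rightarrow> int \<Rightarrow> int \<Rightarrow> (int \<times> int \<Rightarrow> real) \<Rightarrow> real" where
  "field_of g n m x = g (restrict (\<lambda>(a, b). x (n + a, m + b)) quadrant)"

definition commuting_filtration :: "(int \<times> int \<Rightarrow> real) measure \<Rightarrow> bool" where
  "commuting_filtration P \<longleftrightarrow>
     (\<forall>X a b u v. integrable P X \<longrightarrow> u \<le> a \<longrightarrow>
        (AE x in P. real_cond_exp P (filtr u v) (real_cond_exp P (filtr a b) X) x
                  = real_cond_exp P (filtr u (min b v)) X x))"

definition proj_op :: "(int \<times> int \<Rightarrow> real) measure \<Rightarrow> int \<Rightarrow> int \<Rightarrow>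
    ((int \<times> int \<Rightarrow> real) \<Rightarrow> real) \<Rightarrow> (int \<times> int \<Rightarrow> real) \<Rightarrow> real" where
  "proj_op P u v X x =
     real_cond_exp P (filtr u v) X x - real_cond_exp P (filtr u (v - 1)) X x
     - real_cond_exp P (filtr (u - 1) v) X x + real_cond_exp P (filtr (u - 1) (v - 1)) X x"

definition partial_sum ::
    "(int \<Rightarrow> int \<Rightarrow> 'a \<Rightarrow> real) \<Rightarrow> nat \<Rightarrow> nat \<Rightarrow> 'a \<Rightarrow> real" where
  "partial_sum X n m x = (\<Sum>u = 1..int n. \<Sum>v = 1..int m. X u v x)"

definition square_integrable :: "'a measure \<Rightarrow> ('a \<Rightarrow> real) \<Rightarrow> bool" where
  "square_integrable M X \<longleftrightarrow> X \<in> borel_measurable M \<and> integrable M (\<lambda>x. (X x)\<^sup>2)"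

text \<open>The squared \<open>L\<^sup>2\<close> norm takes values in \<open>[0, \<infinity>]\<close>.  The Bochner integral of a
  non-integrable function is 0, so a real-valued version would make \<open>\<parallel>S - M\<parallel>\<close> vanish
  spuriously for martingale differences that are merely integrable.\<close>

definition l2_norm_sq :: "'a measure \<Rightarrow> ('a \<Rightarrow> real) \<Rightarrow> ennreal" where
  "l2_norm_sq M X = (\<integral>\<^sup>+ x. ennreal ((X x)\<^sup>2) \<partial>M)"

definition min_at_top :: "(nat \<times> nat) filter" where
  "min_at_top = filtercomap (\<lambda>(n, m). min n m) at_top"

definition martingale_differences_field :: "(int \<times> int \<Rightarrow> real) measure \<Rightarrow>
    (int \<Rightarrow> int \<Rightarrow> (int \<times> int \<Rightarrow> real) \<Rightarrow> real) \<Rightarrow> bool" where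
  "martingale_differences_field P D \<longleftrightarrow>
     (\<exists>d \<in> past_functionals. D = field_of d) \<and>
     (\<forall>n m. integrable P (D n m)) \<and>
     (\<forall>n m a b. a < n \<or> b < m \<longrightarrow> (AE x in P. real_cond_exp P (filtr a b) (D n m) x = 0))"

definition admits_martingale_approximation :: "(int \<times> int \<Rightarrow> real) measure \<Rightarrow>
    (int \<Rightarrow> int \<Rightarrow> (int \<times> int \<Rightarrow> real) \<Rightarrow> real) \<Rightarrow> bool" where
  "admits_martingale_approximation P X \<longleftrightarrow>
     (\<exists>D. martingale_differences_field P D \<and>
        ((\<lambda>(n, m). ennreal (1 / (real n * real m)) *
             l2_norm_sq P (\<lambda>x. partial_sum X n m x - partial_sum D n m x))
         \<longlongrightarrow> 0) min_at_top)"

end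

theory Submission
  imports Defs
begin

text \<open>Call a square integrable \<open>\<F>\<^sub>1\<^sub>,\<^sub>1\<close>-measurable \<open>Z\<close> that is orthogonal to every \<open>L\<^sup>2(\<F>\<^sub>a\<^sub>,\<^sub>b)\<close> with \<open>a < 1\<close> or
  \<open>b < 1\<close> an innovation, and let \<open>M\<^sub>n\<^sub>,\<^sub>m(Z)\<close> be the sum of its shifts by \<open>(p, q)\<close>,
  \<open>p < n\<close>, \<open>q < m\<close>.  Distinct shifts of innovations are orthogonal, so
  \<open>\<parallel>M\<^sub>n\<^sub>,\<^sub>m(Z)\<parallel>\<^sup>2 = n m \<parallel>Z\<parallel>\<^sup>2\<close>, and stationarity gives
  \<open>\<langle>S\<^sub>n\<^sub>,\<^sub>m, M\<^sub>n\<^sub>,\<^sub>m(Z)\<rangle> = (\<Sum>j\<le>n. \<Sum>k\<le>m. \<langle>S\<^sub>j\<^sub>,\<^sub>k, Z\<rangle>) = n m \<langle>A\<^sub>n\<^sub>,\<^sub>m, Z\<rangle>\<close>, where \<open>A\<^sub>n\<^sub>,\<^sub>m\<close> is the average of the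
  \<open>P\<^sub>1\<^sub>,\<^sub>1(S\<^sub>j\<^sub>,\<^sub>k)\<close>: since the filtration is commuting, \<open>P\<^sub>1\<^sub>,\<^sub>1\<close> is the orthogonal projection onto the
  innovations.

  If \<open>D\<close> is a martingale approximation, apply this to \<open>Z = A\<^sub>n\<^sub>,\<^sub>m - D\<^sub>1\<^sub>,\<^sub>1\<close> and the field \<open>X - D\<close>:
  Cauchy--Schwarz gives \<open>n m \<parallel>A\<^sub>n\<^sub>,\<^sub>m - D\<^sub>1\<^sub>,\<^sub>1\<parallel>\<^sup>2 \<le> \<parallel>S\<^sub>n\<^sub>,\<^sub>m - M\<^sub>n\<^sub>,\<^sub>m\<parallel>\<^sup>2\<close>.  Conversely, put
  \<open>Z = P\<^sub>1\<^sub>,\<^sub>1(D)\<close> and expand \<open>\<parallel>S\<^sub>n\<^sub>,\<^sub>m - M\<^sub>n\<^sub>,\<^sub>m(Z)\<parallel>\<^sup>2 = \<parallel>S\<^sub>n\<^sub>,\<^sub>m\<parallel>\<^sup>2 - 2 n m \<langle>A\<^sub>n\<^sub>,\<^sub>m, D\<rangle> + n m \<parallel>Z\<parallel>\<^sup>2\<close>.\<close>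

section \<open>Square integrable functions\<close>

text \<open>The pairing is real-valued: as a Bochner integral it is 0 when the product is not
  integrable, which is why the additivity rules carry \<open>square_integrable\<close>
  hypotheses.\<close>

definition L2_inner :: "'a measure \<Rightarrow> ('a \<Rightarrow> real) \<Rightarrow> ('a \<Rightarrow> real) \<Rightarrow> real" where
  "L2_inner M f g = (\<integral>x. f x * g x \<partial>M)"

lemma square_integrable_measurable:
  "square_integrable M f \<Longrightarrow> f \<in> borel_measurable M"
  by (simp add: square_integrable_def)

lemma integrable_mult_square_integrable:
  assumes f: "square_integrable M f" and g: "square_integrable M g"
  shows "integrable M (\<lambda>x. f x * g x)"
proof (rule Bochner_Integration.integrable_bound)
  show "integrable M (\<lambda>x. (f x)\<^sup>2 + (g x)\<^sup>2)"
    using f g unfolding square_integrable_def by (intro Bochner_Integration.integrable_add) auto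
  show "(\<lambda>x. f x * g x) \<in> borel_measurable M"
    using f g unfolding square_integrable_def by (intro borel_measurable_times) auto
  have "\<bar>a * b\<bar> \<le> a\<^sup>2 + b\<^sup>2" for a b :: real
  proof -
    have "2 * \<bar>a\<bar> * \<bar>b\<bar> \<le> a\<^sup>2 + b\<^sup>2"
      using sum_squares_bound[of "\<bar>a\<bar>" "\<bar>b\<bar>"] by simp
    moreover have "0 \<le> \<bar>a\<bar> * \<bar>b\<bar>" by simp
    ultimately show ?thesis unfolding abs_mult by linarith
  qed
  then show "AE x in M. norm (f x * g x) \<le> norm ((f x)\<^sup>2 + (g x)\<^sup>2)"
    by simp
qed

lemma square_integrable_scale:
  "square_integrable M f \<Longrightarrow> square_integrable M (\<lambda>x. c * f x)"
  by (auto simp: square_integrable_def power_mult_distrib)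

lemma square_integrable_add:
  assumes "square_integrable M f" "square_integrable M g"
  shows "square_integrable M (\<lambda>x. f x + g x)"
  using assms integrable_mult_square_integrable[OF assms]
  by (auto simp: square_integrable_def power2_sum mult.assoc)

lemma square_integrable_diff:
  assumes "square_integrable M f" "square_integrable M g"
  shows "square_integrable M (\<lambda>x. f x - g x)"
  using square_integrable_add[OF assms(1) square_integrable_scale[OF assms(2), of "-1"]] by simp

lemma square_integrable_zero: "square_integrable M (\<lambda>x. 0)"
  by (simp add: square_integrable_def)

lemma square_integrable_sum:
  assumes "\<And>i. i \<in> I \<Longrightarrow> square_integrable M (f i)"
  shows "square_integrable M (\<lambda>x. \<Sum>i\<in>I. f i x)"
  using assms
  by (induction I rule: infinite_finite_induct)
     (auto simp: square_integrable_zero intro: square_integrable_add)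

lemma L2_inner_commute: "L2_inner M f g = L2_inner M g f"
  by (simp add: L2_inner_def mult.commute)

lemma L2_inner_nonneg: "L2_inner M f f \<ge> 0"
  by (simp add: L2_inner_def)

lemma L2_inner_cong_AE:
  assumes "AE x in M. f x = f' x" "AE x in M. g x = g' x"
    "f \<in> borel_measurable M" "f' \<in> borel_measurable M"
    "g \<in> borel_measurable M" "g' \<in> borel_measurable M"
  shows "L2_inner M f g = L2_inner M f' g'"
  unfolding L2_inner_def using assms by (intro integral_cong_AE) auto

lemma L2_inner_scale_left: "L2_inner M (\<lambda>x. c * f x) g = c * L2_inner M f g"
  by (simp add: L2_inner_def mult.assoc)

lemma L2_inner_scale_right: "L2_inner M f (\<lambda>x. c * g x) = c * L2_inner M f g"
  by (simp add: L2_inner_commute[of M f] L2_inner_scale_left)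

lemma L2_inner_add_left:
  assumes "square_integrable M f" "square_integrable M g" "square_integrable M h"
  shows "L2_inner M (\<lambda>x. f x + g x) h = L2_inner M f h + L2_inner M g h"
  using assms by (simp add: L2_inner_def distrib_right integrable_mult_square_integrable)

lemma L2_inner_diff_left:
  assumes "square_integrable M f" "square_integrable M g" "square_integrable M h"
  shows "L2_inner M (\<lambda>x. f x - g x) h = L2_inner M f h - L2_inner M g h"
  using assms by (simp add: L2_inner_def left_diff_distrib integrable_mult_square_integrable)

lemma L2_inner_diff_right:
  assumes "square_integrable M f" "square_integrable M g" "square_integrable M h"
  shows "L2_inner M h (\<lambda>x. f x - g x) = L2_inner M h f - L2_inner M h g"
  using L2_inner_diff_left[OF assms] by (simp add: L2_inner_commute)

lemma L2_inner_sum_left: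
  assumes "\<And>i. i \<in> I \<Longrightarrow> square_integrable M (f i)" "square_integrable M g"
  shows "L2_inner M (\<lambda>x. \<Sum>i\<in>I. f i x) g = (\<Sum>i\<in>I. L2_inner M (f i) g)"
  using assms
  by (simp add: L2_inner_def sum_distrib_right integrable_mult_square_integrable)

lemma L2_inner_sum_right:
  assumes "\<And>i. i \<in> I \<Longrightarrow> square_integrable M (f i)" "square_integrable M g"
  shows "L2_inner M g (\<lambda>x. \<Sum>i\<in>I. f i x) = (\<Sum>i\<in>I. L2_inner M g (f i))"
  using L2_inner_sum_left[of I M f g] assms by (simp add: L2_inner_commute[of M g])

lemma L2_inner_diff_self:
  assumes "square_integrable M f" "square_integrable M g"
  shows "L2_inner M (\<lambda>x. f x - g x) (\<lambda>x. f x - g x)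
    = L2_inner M f f - 2 * L2_inner M f g + L2_inner M g g"
  using assms
  by (simp add: L2_inner_diff_left L2_inner_diff_right square_integrable_diff
      L2_inner_commute[of M g f])

text \<open>The squared norm of \<open>f - t * g\<close> is a nonnegative polynomial in t. Its value
  at the minimiser \<open>?b / ?c\<close> gives the bound; if \<open>?c = 0\<close> the polynomial
  is affine, so its slope must vanish.\<close>

lemma L2_Cauchy_Schwarz:
  assumes f: "square_integrable M f" and g: "square_integrable M g"
  shows "(L2_inner M f g)\<^sup>2 \<le> L2_inner M f f * L2_inner M g g"
proof -
  let ?a = "L2_inner M f f" and ?b = "L2_inner M f g" and ?c = "L2_inner M g g"
  have q: "0 \<le> ?a - 2 * t * ?b + t\<^sup>2 * ?c" for t
    using L2_inner_nonneg[of M "\<lambda>x. f x - t * g x"]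
      L2_inner_diff_self[OF f square_integrable_scale[OF g, of t]]
    by (simp add: L2_inner_scale_left L2_inner_scale_right power2_eq_square mult.assoc)
  show ?thesis
  proof (cases "?c = 0")
    case True
    have "?b = 0"
    proof (rule ccontr)
      assume "?b \<noteq> 0"
      \<comment> \<open>At this t the affine polynomial \<open>?a - 2 * t * ?b\<close> takes the
        value -1.\<close>
      with q[of "(?a + 1) / (2 * ?b)"] True show False by simp
    qed
    with True show ?thesis by simp
  next
    case False
    then have "?c > 0" using L2_inner_nonneg[of M g] by simp
    with q[of "?b / ?c"] show ?thesis
      by (simp add: field_simps power2_eq_square)
  qed
qed

lemma AE_eq_0_if_L2_inner_self_eq_0:
  assumes "square_integrable M f" "L2_inner M f f = 0"
  shows "AE x in M. f x = 0"
proof -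
  have "AE x in M. (f x)\<^sup>2 = 0"
    using assms integral_nonneg_eq_0_iff_AE[of M "\<lambda>x. (f x)\<^sup>2"]
    by (simp add: square_integrable_def L2_inner_def power2_eq_square)
  then show ?thesis by simp
qed

lemma l2_norm_sq_eq:
  assumes "square_integrable M f"
  shows "l2_norm_sq M f = ennreal (L2_inner M f f)"
  using assms
  by (simp add: l2_norm_sq_def L2_inner_def square_integrable_def nn_integral_eq_integral
      power2_eq_square)

lemma square_integrable_if_l2_norm_sq_finite:
  assumes "f \<in> borel_measurable M" "l2_norm_sq M f < \<infinity>"
  shows "square_integrable M f"
  unfolding square_integrable_def
proof
  show "integrable M (\<lambda>x. (f x)\<^sup>2)"
    using assms by (intro integrableI_nonneg) (simp_all add: l2_norm_sq_def)
qed (rule assms)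

section \<open>Shifts and the filtration\<close>

text \<open>Integer displacements in both coordinates make the shifts a group, so every shift can be
  undone by \<open>shift (- p) (- q)\<close>. The two unit shifts are \<open>shift 1 0\<close> and
  \<open>shift 0 1\<close>.\<close>

definition shift :: "int \<Rightarrow> int \<Rightarrow> (int \<times> int \<Rightarrow> real) \<Rightarrow> int \<times> int \<Rightarrow> real" where
  "shift p q x = (\<lambda>(u, v). x (u + p, v + q))"

lemma shift_shift: "shift p q (shift p' q' x) = shift (p + p') (q + q') x"
  by (auto simp: shift_def ac_simps)

lemma shift_0: "shift 0 0 = id"
  by (auto simp: shift_def)

lemma measurable_shift_config: "shift p q \<in> measurable config_space config_space"
  unfolding config_space_def
proof (rule measurable_PiM_single')
  show "(\<lambda>x. shift p q x i) \<in> borel_measurable (\<Pi>\<^sub>M i\<in>UNIV. borel)" for i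
    by (cases i) (simp add: shift_def)
qed (auto simp: space_PiM)

lemma space_filtr [simp]: "space (filtr a b) = UNIV"
  by (simp add: filtr_def space_measure_of_conv)

lemma sets_filtr:
  "sets (filtr a b) = sigma_sets UNIV
     {(\<lambda>x. x (i, j)) -` B | i j B. i \<le> a \<and> j \<le> b \<and> B \<in> sets borel}"
  by (simp add: filtr_def)

lemma measurable_coordinate_filtr:
  assumes "i \<le> a" "j \<le> b"
  shows "(\<lambda>x. x (i, j)) \<in> borel_measurable (filtr a b)"
proof (rule measurableI)
  fix B :: "real set" assume "B \<in> sets borel"
  with assms have "(\<lambda>x. x (i, j)) -` B \<in> sets (filtr a b)"
    unfolding sets_filtr by (intro sigma_sets.Basic) blast
  then show "(\<lambda>x. x (i, j)) -` B \<inter> space (filtr a b) \<in> sets (filtr a b)"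
    by simp
qed simp

lemma measurable_filtrI:
  assumes "\<And>i j. i \<le> a \<Longrightarrow> j \<le> b \<Longrightarrow> (\<lambda>x. F x (i, j)) \<in> borel_measurable N"
  shows "F \<in> measurable N (filtr a b)"
  unfolding filtr_def
proof (rule measurable_measure_of)
  fix C assume "C \<in> {(\<lambda>x. x (i, j)) -` B | i j B. i \<le> a \<and> j \<le> b \<and> B \<in> sets (borel :: real measure)}"
  then obtain i j B where C: "C = (\<lambda>x. x (i, j)) -` B" "i \<le> a" "j \<le> b" "B \<in> sets (borel :: real measure)"
    by blast
  have "F -` C \<inter> space N = (\<lambda>x. F x (i, j)) -` B \<inter> space N"
    using C(1) by auto
  also have "\<dots> \<in> sets N"
    using assms[OF C(2,3)] C(4) by (rule measurable_sets)
  finally show "F -` C \<inter> space N \<in> sets N" .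
qed auto

lemma measurable_shift_filtr: "shift p q \<in> measurable (filtr (a + p) (b + q)) (filtr a b)"
  by (rule measurable_filtrI) (simp add: shift_def measurable_coordinate_filtr)

lemma sets_filtr_mono:
  assumes "a \<le> a'" "b \<le> b'"
  shows "sets (filtr a b) \<subseteq> sets (filtr a' b')"
proof -
  \<comment> \<open>Inclusion of sigma-fields is read as measurability of the identity map, which is
    checked on coordinates.\<close>
  have "(\<lambda>x. x) \<in> measurable (filtr a' b') (filtr a b)"
    using assms by (intro measurable_filtrI measurable_coordinate_filtr) auto
  from measurable_sets[OF this] show ?thesis by auto
qed

lemma measurable_filtr_mono:
  assumes "a \<le> a'" "b \<le> b'" "f \<in> borel_measurable (filtr a b)"
  shows "f \<in> borel_measurable (filtr a' b')"
  using assms(3) sets_filtr_mono[OF assms(1,2)] by (auto simp: measurable_def)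

text \<open>Depending only on the coordinates of the past is true of the generating cylinders and
  survives complements and countable unions.\<close>

lemma filtr_set_determined_by_past:
  assumes "A \<in> sets (filtr a b)" "\<And>i j. i \<le> a \<Longrightarrow> j \<le> b \<Longrightarrow> x (i, j) = y (i, j)"
  shows "x \<in> A \<longleftrightarrow> y \<in> A"
  using assms(1) unfolding sets_filtr
  by (induction rule: sigma_sets.induct) (use assms(2) in auto)

lemma filtr_function_determined_by_past:
  fixes G :: "(int \<times> int \<Rightarrow> real) \<Rightarrow> real"
  assumes "G \<in> borel_measurable (filtr a b)" "\<And>i j. i \<le> a \<Longrightarrow> j \<le> b \<Longrightarrow> x (i, j) = y (i, j)"
  shows "G x = G y"
proof -
  \<comment> \<open>The level set of \<open>G\<close> through \<open>x\<close> belongs to the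
    sigma-field, so it contains \<open>y\<close> as well.\<close>
  have "G -` {G x} \<inter> space (filtr a b) \<in> sets (filtr a b)"
    using assms(1) by (rule measurable_sets) simp
  from filtr_set_determined_by_past[OF this, of x y] assms(2) show ?thesis by auto
qed

section \<open>Fields generated by one functional of the past\<close>

lemma measurable_field_of:
  assumes "g \<in> past_functionals"
  shows "field_of g n m \<in> borel_measurable (filtr n m)"
proof -
  have "(\<lambda>x. restrict (\<lambda>(a, b). x (n + a, m + b)) quadrant)
      \<in> measurable (filtr n m) (PiM quadrant (\<lambda>_. borel))"
    by (rule measurable_restrict)
      (auto simp: quadrant_def intro!: measurable_coordinate_filtr)
  from measurable_compose[OF this] assms show ?thesis
    by (simp add: past_functionals_def field_of_def[abs_def])
qed

lemma field_of_shift: "field_of g n m (shift p q x) = field_of g (n + p) (m + q) x"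
  by (auto simp: field_of_def shift_def ac_simps intro!: arg_cong[where f = g])

lemma field_of_diff:
  "field_of (\<lambda>y. f y - g y) n m x = field_of f n m x - field_of g n m x"
  by (simp add: field_of_def)

text \<open>A Doob-Dynkin representation: a configuration on the quadrant is moved to the past of
  (a, b) and fed to \<open>G\<close>. It turns a single measurable variable into a whole stationary
  field.\<close>

lemma measurable_filtr_eq_field_of:
  assumes "G \<in> borel_measurable (filtr a b)"
  obtains g where "g \<in> past_functionals" "field_of g a b = G"
proof
  \<comment> \<open>The value 0 outside the past is arbitrary, because \<open>G\<close> does not
    depend on those coordinates.\<close>
  define ext :: "(int \<times> int \<Rightarrow> real) \<Rightarrow> int \<times> int \<Rightarrow> real" where
    "ext y = (\<lambda>(i, j). if i \<le> a \<and> j \<le> b then y (i - a, j - b) else 0)" for y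
  have "ext \<in> measurable (PiM quadrant (\<lambda>_. borel)) (filtr a b)"
    by (rule measurable_filtrI)
      (auto simp: ext_def quadrant_def intro!: measurable_component_singleton)
  from measurable_compose[OF this assms]
  show "(\<lambda>y. G (ext y)) \<in> past_functionals"
    by (simp add: past_functionals_def)
  show "field_of (\<lambda>y. G (ext y)) a b = G"
    unfolding field_of_def
    by (intro HOL.ext filtr_function_determined_by_past[OF assms]) (simp add: ext_def quadrant_def)
qed

text \<open>Reindexing gives the range from 1 - p to n - p, whose part below 1 contributes nothing.
  With p <= n the natural subtraction agrees with the integer one.\<close>

lemma sum_shift_int:
  fixes c :: "int \<Rightarrow> real"
  assumes "p \<le> n" "\<And>i. i < 1 \<Longrightarrow> c i = 0"
  shows "(\<Sum>u=1..int n. c (u - int p)) = (\<Sum>u=1..int (n - p). c u)"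
proof -
  have "(\<Sum>u=1..int n. c (u - int p)) = (\<Sum>u=1 - int p..int (n - p). c u)"
    using assms(1)
    by (intro sum.reindex_bij_witness[where i = "\<lambda>u. u + int p" and j = "\<lambda>u. u - int p"]) auto
  also have "\<dots> = (\<Sum>u=1..int (n - p). c u)"
    using assms(2) by (intro sum.mono_neutral_right) auto
  finally show ?thesis .
qed

section \<open>Martingale differences in \<open>L\<^sup>2\<close>\<close>

locale stationary_measure =
  fixes P :: "(int \<times> int \<Rightarrow> real) measure"
  assumes stationary: "stationary_law P"
begin

sublocale prob_space P
  using stationary by (simp add: stationary_law_def)

lemma sets_P: "sets P = sets config_space"
  using stationary by (simp add: stationary_law_def)

lemma space_P [simp]: "space P = UNIV"
  using sets_eq_imp_space_eq[OF sets_P] by (simp add: config_space_def space_PiM)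

lemma measurable_shift [measurable]: "shift p q \<in> measurable P P"
  using measurable_shift_config measurable_cong_sets[OF sets_P sets_P] by blast

lemma subalgebra_filtr: "subalgebra P (filtr a b)"
proof -
  have "(\<lambda>x. x (i, j)) \<in> borel_measurable P" for i j
    unfolding measurable_cong_sets[OF sets_P refl] config_space_def by measurable
  then have "(\<lambda>x. x) \<in> measurable P (filtr a b)"
    by (rule measurable_filtrI)
  from measurable_sets[OF this] show ?thesis by (auto simp: subalgebra_def)
qed

sublocale cond: finite_measure_subalgebra P "filtr a b" for a b
  by unfold_locales (rule subalgebra_filtr)

lemma borel_measurable_filtr_P:
  "f \<in> borel_measurable (filtr a b) \<Longrightarrow> f \<in> borel_measurable P"
  by (rule measurable_from_subalg[OF subalgebra_filtr])

section \<open>Invariance of the law under all shifts\<close>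

lemma distr_shift_inverse:
  assumes "distr P P (shift p q) = P"
  shows "distr P P (shift (- p) (- q)) = P"
proof -
  have "distr P P (shift (- p) (- q)) = distr (distr P P (shift p q)) P (shift (- p) (- q))"
    using assms by simp
  also have "\<dots> = distr P P (\<lambda>x. x)"
    by (subst distr_distr) (auto simp: comp_def shift_shift shift_0)
  finally show ?thesis by (simp add: distr_id)
qed

lemma distr_shift_add:
  assumes "distr P P (shift p q) = P" "distr P P (shift p' q') = P"
  shows "distr P P (shift (p + p') (q + q')) = P"
proof -
  have "distr P P (shift (p + p') (q + q')) = distr (distr P P (shift p' q')) P (shift p q)"
    by (subst distr_distr) (auto simp: comp_def shift_shift)
  then show ?thesis using assms by simp
qed

text \<open>The shifts preserving the law form a group containing both unit shifts. Each coordinate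
  is treated by two-sided induction on the integers, the downward step using the inverse unit
  shift.\<close>

lemma distr_shift: "distr P P (shift p q) = P"
proof -
  have T: "distr P P (shift 1 0) = P" and S: "distr P P (shift 0 1) = P"
    using stationary by (simp_all add: stationary_law_def shift_def[abs_def] shiftT_def[abs_def] shiftS_def[abs_def])
  have id: "distr P P (shift 0 0) = P"
    by (simp add: shift_0 id_def distr_id)
  have p: "distr P P (shift p 0) = P"
  proof (induction p rule: int_induct[where k = 0])
    case base
    show ?case by (rule id)
  next
    case (step1 i)
    from distr_shift_add[OF this(2) T] show ?case by simp
  next
    case (step2 i)
    from distr_shift_add[OF this(2) distr_shift_inverse[OF T]] show ?case by simp
  qed
  have q: "distr P P (shift 0 q) = P"
  proof (induction q rule: int_induct[where k = 0])
    case base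
    show ?case by (rule id)
  next
    case (step1 i)
    from distr_shift_add[OF this(2) S] show ?case by simp
  next
    case (step2 i)
    from distr_shift_add[OF this(2) distr_shift_inverse[OF S]] show ?case by simp
  qed
  from distr_shift_add[OF p q] show ?thesis by simp
qed

lemma integral_shift:
  fixes f :: "(int \<times> int \<Rightarrow> real) \<Rightarrow> real"
  assumes "f \<in> borel_measurable P"
  shows "(\<integral>x. f (shift p q x) \<partial>P) = (\<integral>x. f x \<partial>P)"
  using integral_distr[OF measurable_shift assms, of p q] by (simp add: distr_shift)

lemma square_integrable_shift:
  assumes "square_integrable P f"
  shows "square_integrable P (\<lambda>x. f (shift p q x))"
proof -
  have f: "f \<in> borel_measurable P" "integrable P (\<lambda>x. (f x)\<^sup>2)"
    using assms by (auto simp: square_integrable_def)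
  have "integrable P (\<lambda>x. (f (shift p q x))\<^sup>2)"
    using integrable_distr[OF measurable_shift, of p q "\<lambda>x. (f x)\<^sup>2"] f by (simp add: distr_shift)
  with f show ?thesis unfolding square_integrable_def by simp
qed

lemma L2_inner_shift:
  assumes "square_integrable P f" "square_integrable P g"
  shows "L2_inner P (\<lambda>x. f (shift p q x)) (\<lambda>x. g (shift p q x)) = L2_inner P f g"
  using integral_shift[of "\<lambda>x. f x * g x" p q] integrable_mult_square_integrable[OF assms]
  by (simp add: L2_inner_def borel_measurable_integrable)

lemma integrable_if_square_integrable:
  "square_integrable P f \<Longrightarrow> integrable P f"
  unfolding square_integrable_def by (blast intro: square_integrable_imp_integrable)

section \<open>Conditional expectation as an orthogonal projection\<close>

abbreviation E :: "int \<Rightarrow> int \<Rightarrow> ((int \<times> int \<Rightarrow> real) \<Rightarrow> real) \<Rightarrow> (int \<times> int \<Rightarrow> real) \<Rightarrow> real" where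
  "E a b \<equiv> real_cond_exp P (filtr a b)"

text \<open>This is the conditional Jensen inequality for the square function.\<close>

lemma square_integrable_cond_exp:
  assumes "square_integrable P f"
  shows "square_integrable P (E a b f)"
  unfolding square_integrable_def
proof
  show "integrable P (\<lambda>x. (E a b f x)\<^sup>2)"
  proof (rule cond.integrable_convex_cond_exp[where I = UNIV])
    show "convex_on UNIV (\<lambda>x::real. x\<^sup>2)"
      by (rule convex_power2)
    show "integrable P f"
      using assms by (rule integrable_if_square_integrable)
    show "integrable P (\<lambda>x. (f x)\<^sup>2)"
      using assms by (simp add: square_integrable_def)
  qed simp_all
qed (rule borel_measurable_cond_exp2)

lemma L2_inner_cond_exp_left:
  assumes "square_integrable P f" "square_integrable P g" "g \<in> borel_measurable (filtr a b)"
  shows "L2_inner P (E a b f) g = L2_inner P f g"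
proof -
  have "L2_inner P g (E a b f) = L2_inner P g f"
    unfolding L2_inner_def
    using integrable_mult_square_integrable[OF assms(2,1)] assms(3)
      square_integrable_measurable[OF assms(1)]
    by (rule cond.real_cond_exp_intg(2))
  then show ?thesis by (simp only: L2_inner_commute[of P _ g])
qed

text \<open>Both sides equal the pairing of \<open>E a b f\<close> with \<open>E a b g\<close>,
  since conditioning one factor is free once the other is measurable.\<close>

lemma L2_inner_cond_exp_adjoint:
  assumes "square_integrable P f" "square_integrable P g"
  shows "L2_inner P (E a b f) g = L2_inner P f (E a b g)"
proof -
  have "L2_inner P f (E a b g) = L2_inner P (E a b f) (E a b g)"
    using assms by (intro L2_inner_cond_exp_left[symmetric] square_integrable_cond_exp borel_measurable_cond_exp)
  also have "\<dots> = L2_inner P (E a b g) (E a b f)" by (rule L2_inner_commute)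
  also have "\<dots> = L2_inner P g (E a b f)"
    using assms by (intro L2_inner_cond_exp_left square_integrable_cond_exp borel_measurable_cond_exp)
  finally show ?thesis by (simp only: L2_inner_commute[of P g])
qed

text \<open>Orthogonality to the earlier \<open>\<sigma>\<close>-fields is stated without conditional expectations, so that
  it visibly commutes with shifts.\<close>

definition mdiff :: "int \<Rightarrow> int \<Rightarrow> ((int \<times> int \<Rightarrow> real) \<Rightarrow> real) \<Rightarrow> bool" where
  "mdiff u v Z \<longleftrightarrow> square_integrable P Z \<and> Z \<in> borel_measurable (filtr u v) \<and>
     (\<forall>a b W. (a < u \<or> b < v) \<longrightarrow> square_integrable P W \<longrightarrow> W \<in> borel_measurable (filtr a b)
        \<longrightarrow> L2_inner P Z W = 0)"

lemma mdiff_square_integrable: "mdiff u v Z \<Longrightarrow> square_integrable P Z"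
  and mdiff_measurable: "mdiff u v Z \<Longrightarrow> Z \<in> borel_measurable (filtr u v)"
  by (simp_all add: mdiff_def)

lemma mdiff_orthogonal_past:
  "mdiff u v Z \<Longrightarrow> a < u \<or> b < v \<Longrightarrow> square_integrable P W
    \<Longrightarrow> W \<in> borel_measurable (filtr a b) \<Longrightarrow> L2_inner P Z W = 0"
  unfolding mdiff_def by blast

text \<open>Two distinct indices differ in some coordinate, and the one that is smaller there lies
  in the excluded past of the other. The disjunction in \<open>mdiff\<close> is what makes any two
  distinct indices comparable in this sense.\<close>

lemma mdiff_orthogonal:
  assumes "mdiff u v Z" "mdiff u' v' Z'" "(u, v) \<noteq> (u', v')"
  shows "L2_inner P Z Z' = 0"
proof -
  consider "u' < u \<or> v' < v" | "u < u' \<or> v < v'" using assms(3) by force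
  then show ?thesis
  proof cases
    case 1
    then show ?thesis
      by (rule mdiff_orthogonal_past[OF assms(1) _ mdiff_square_integrable[OF assms(2)]
            mdiff_measurable[OF assms(2)]])
  next
    case 2
    then have "L2_inner P Z' Z = 0"
      by (rule mdiff_orthogonal_past[OF assms(2) _ mdiff_square_integrable[OF assms(1)]
            mdiff_measurable[OF assms(1)]])
    then show ?thesis by (simp only: L2_inner_commute[of P Z Z'])
  qed
qed

text \<open>A test function for the shifted index is carried back by the inverse shift, where it
  becomes a test function for \<open>Z\<close>; invariance of the law preserves the pairing.\<close>

lemma mdiff_shift:
  assumes "mdiff u v Z"
  shows "mdiff (u + p) (v + q) (\<lambda>x. Z (shift p q x))"
  unfolding mdiff_def
proof (intro conjI allI impI)
  show "square_integrable P (\<lambda>x. Z (shift p q x))"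
    using assms by (intro square_integrable_shift mdiff_square_integrable)
  show "(\<lambda>x. Z (shift p q x)) \<in> borel_measurable (filtr (u + p) (v + q))"
    using assms by (intro measurable_compose[OF measurable_shift_filtr] mdiff_measurable)
  fix a b W assume ab: "a < u + p \<or> b < v + q" and W: "square_integrable P W"
    and Wm: "W \<in> borel_measurable (filtr a b)"
  define V where "V x = W (shift (- p) (- q) x)" for x
  have V: "square_integrable P V"
    unfolding V_def using W by (rule square_integrable_shift)
  have "V \<in> borel_measurable (filtr (a - p) (b - q))"
    unfolding V_def
    using measurable_compose[OF measurable_shift_filtr[of "- p" "- q" a b] Wm] by simp
  moreover have "a - p < u \<or> b - q < v" using ab by linarith
  ultimately have "L2_inner P Z V = 0"
    using mdiff_orthogonal_past[OF assms _ V] by blast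
  moreover have "W = (\<lambda>x. V (shift p q x))"
    by (simp add: V_def shift_shift shift_0)
  ultimately show "L2_inner P (\<lambda>x. Z (shift p q x)) W = 0"
    using L2_inner_shift[OF mdiff_square_integrable[OF assms] V] by simp
qed

text \<open>Test \<open>Z\<close> against \<open>E a b Z\<close>: the result is the squared norm of
  \<open>E a b Z\<close>. Together with \<open>mdiffI_cond_exp\<close> this identifies
  \<open>mdiff\<close> with the conditional form of martingale differences in the square integrable
  case.\<close>

lemma cond_exp_eq_0_if_mdiff:
  assumes "mdiff u v Z" "a < u \<or> b < v"
  shows "AE x in P. E a b Z x = 0"
proof (rule AE_eq_0_if_L2_inner_self_eq_0)
  have Z: "square_integrable P Z" using assms(1) by (rule mdiff_square_integrable)
  show E: "square_integrable P (E a b Z)" using Z by (rule square_integrable_cond_exp)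
  have "L2_inner P (E a b Z) (E a b Z) = L2_inner P Z (E a b Z)"
    using Z E by (intro L2_inner_cond_exp_left borel_measurable_cond_exp)
  also have "\<dots> = 0"
    using E by (intro mdiff_orthogonal_past[OF assms] borel_measurable_cond_exp)
  finally show "L2_inner P (E a b Z) (E a b Z) = 0" .
qed

lemma mdiffI_cond_exp:
  assumes "square_integrable P Z" "Z \<in> borel_measurable (filtr u v)"
    and "\<And>a b. a < u \<or> b < v \<Longrightarrow> AE x in P. E a b Z x = 0"
  shows "mdiff u v Z"
  unfolding mdiff_def
proof (intro conjI allI impI)
  fix a b W assume ab: "a < u \<or> b < v" and W: "square_integrable P W"
    and Wm: "W \<in> borel_measurable (filtr a b)"
  have "L2_inner P Z W = L2_inner P (E a b Z) W"
    using assms(1) W Wm by (rule L2_inner_cond_exp_left[symmetric])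
  also have "\<dots> = L2_inner P (\<lambda>x. 0) W"
    using assms(3)[OF ab] square_integrable_measurable[OF W]
    by (intro L2_inner_cong_AE borel_measurable_cond_exp2 borel_measurable_const) simp_all
  finally show "L2_inner P Z W = 0" by (simp add: L2_inner_def)
qed (use assms in auto)

lemma mdiff_sum_orthogonal:
  assumes "finite I" and inj: "inj_on (\<lambda>i. (u i, v i)) I"
    and Z: "\<And>i. i \<in> I \<Longrightarrow> mdiff (u i) (v i) (Z i)"
  shows "L2_inner P (\<lambda>x. \<Sum>i\<in>I. Z i x) (\<lambda>x. \<Sum>i\<in>I. Z i x) = (\<Sum>i\<in>I. L2_inner P (Z i) (Z i))"
proof -
  have sq: "square_integrable P (Z i)" if "i \<in> I" for i
    using Z[OF that] by (rule mdiff_square_integrable)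
  have "L2_inner P (\<lambda>x. \<Sum>i\<in>I. Z i x) (\<lambda>x. \<Sum>i\<in>I. Z i x)
      = (\<Sum>i\<in>I. \<Sum>j\<in>I. L2_inner P (Z i) (Z j))"
    using sq by (simp add: L2_inner_sum_left L2_inner_sum_right square_integrable_sum)
  also have "\<dots> = (\<Sum>i\<in>I. \<Sum>j\<in>I. if i = j then L2_inner P (Z i) (Z i) else 0)"
  proof (intro sum.cong refl)
    fix i j assume ij: "i \<in> I" "j \<in> I"
    show "L2_inner P (Z i) (Z j) = (if i = j then L2_inner P (Z i) (Z i) else 0)"
    proof (cases "i = j")
      case False
      then have "(u i, v i) \<noteq> (u j, v j)" using ij inj_onD[OF inj] by blast
      with False show ?thesis using mdiff_orthogonal[OF Z[OF ij(1)] Z[OF ij(2)]] by simp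
    qed simp
  qed
  also have "\<dots> = (\<Sum>i\<in>I. L2_inner P (Z i) (Z i))"
    using assms(1) by simp
  finally show ?thesis .
qed

lemma mdiff_scale:
  assumes "mdiff u v Z"
  shows "mdiff u v (\<lambda>x. c * Z x)"
  unfolding mdiff_def
proof (intro conjI allI impI)
  show "(\<lambda>x. c * Z x) \<in> borel_measurable (filtr u v)"
    using mdiff_measurable[OF assms] by (intro borel_measurable_times borel_measurable_const)
  show "L2_inner P (\<lambda>x. c * Z x) W = 0"
    if "a < u \<or> b < v" "square_integrable P W" "W \<in> borel_measurable (filtr a b)" for a b W
    using mdiff_orthogonal_past[OF assms that] by (simp add: L2_inner_scale_left)
qed (intro square_integrable_scale mdiff_square_integrable[OF assms])

lemma mdiff_diff:
  assumes Y: "mdiff u v Y" and Z: "mdiff u v Z"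
  shows "mdiff u v (\<lambda>x. Y x - Z x)"
  unfolding mdiff_def
proof (intro conjI allI impI)
  show "(\<lambda>x. Y x - Z x) \<in> borel_measurable (filtr u v)"
    by (intro borel_measurable_diff mdiff_measurable Y Z)
  show "L2_inner P (\<lambda>x. Y x - Z x) W = 0"
    if "a < u \<or> b < v" "square_integrable P W" "W \<in> borel_measurable (filtr a b)" for a b W
    using mdiff_orthogonal_past[OF Y that] mdiff_orthogonal_past[OF Z that]
    by (simp add: L2_inner_diff_left mdiff_square_integrable[OF Y] mdiff_square_integrable[OF Z] that)
qed (intro square_integrable_diff mdiff_square_integrable[OF Y] mdiff_square_integrable[OF Z])

lemma mdiff_sum:
  assumes Z: "\<And>i. i \<in> I \<Longrightarrow> mdiff u v (Z i)"
  shows "mdiff u v (\<lambda>x. \<Sum>i\<in>I. Z i x)"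
  unfolding mdiff_def
proof (intro conjI allI impI)
  show "(\<lambda>x. \<Sum>i\<in>I. Z i x) \<in> borel_measurable (filtr u v)"
    by (intro borel_measurable_sum mdiff_measurable Z)
  show "L2_inner P (\<lambda>x. \<Sum>i\<in>I. Z i x) W = 0"
    if "a < u \<or> b < v" "square_integrable P W" "W \<in> borel_measurable (filtr a b)" for a b W
    using mdiff_orthogonal_past[OF Z that]
    by (simp add: L2_inner_sum_left mdiff_square_integrable[OF Z] that(2))
qed (intro square_integrable_sum mdiff_square_integrable[OF Z])

section \<open>Pairing partial sums with sums of shifted innovations\<close>

lemma square_integrable_field_of:
  assumes "square_integrable P (field_of g u v)"
  shows "square_integrable P (field_of g u' v')"
  using square_integrable_shift[OF assms, of "u' - u" "v' - v"] by (simp add: field_of_shift)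

lemma square_integrable_partial_sum:
  assumes "\<And>u v. square_integrable P (F u v)"
  shows "square_integrable P (partial_sum F n m)"
  unfolding partial_sum_def[abs_def] by (intro square_integrable_sum assms)

lemma L2_inner_partial_sum:
  assumes "\<And>u v. square_integrable P (F u v)" "square_integrable P Z"
  shows "L2_inner P (partial_sum F n m) Z = (\<Sum>u=1..int n. \<Sum>v=1..int m. L2_inner P (F u v) Z)"
proof -
  have "L2_inner P (partial_sum F n m) Z = (\<Sum>u=1..int n. L2_inner P (\<lambda>x. \<Sum>v=1..int m. F u v x) Z)"
    unfolding partial_sum_def[abs_def] by (intro L2_inner_sum_left square_integrable_sum assms)
  also have "\<dots> = (\<Sum>u=1..int n. \<Sum>v=1..int m. L2_inner P (F u v) Z)"
    by (intro sum.cong refl L2_inner_sum_left assms)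
  finally show ?thesis .
qed

text \<open>By stationarity the pairing of the (u, v) term with the shifted \<open>Z\<close> depends
  only on (u - p, v - q). It vanishes when u <= p or v <= q, as the term then lies in the past of
  the shifted innovation; a smaller rectangle remains.\<close>

lemma L2_inner_partial_sum_shift:
  assumes g: "g \<in> past_functionals" and sq: "square_integrable P (field_of g 0 0)"
    and Z: "mdiff 1 1 Z" and pq: "p \<le> n" "q \<le> m"
  shows "L2_inner P (partial_sum (field_of g) n m) (\<lambda>x. Z (shift (int p) (int q) x))
    = L2_inner P (partial_sum (field_of g) (n - p) (m - q)) Z"
proof -
  define c where "c u v = L2_inner P (field_of g u v) Z" for u v
  have sq': "square_integrable P (field_of g u v)" for u v
    using sq by (rule square_integrable_field_of)
  have Zsq: "square_integrable P Z" using Z by (rule mdiff_square_integrable)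
  have c0: "c u v = 0" if "u < 1 \<or> v < 1" for u v
    unfolding c_def L2_inner_commute[of P _ Z]
    by (rule mdiff_orthogonal_past[OF Z that sq' measurable_field_of[OF g]])
  have "L2_inner P (field_of g u v) (\<lambda>x. Z (shift (int p) (int q) x)) = c (u - int p) (v - int q)" for u v
    using L2_inner_shift[OF sq' Zsq, of "u - int p" "v - int q" "int p" "int q"]
    by (simp add: field_of_shift c_def)
  then have "L2_inner P (partial_sum (field_of g) n m) (\<lambda>x. Z (shift (int p) (int q) x))
      = (\<Sum>u=1..int n. \<Sum>v=1..int m. c (u - int p) (v - int q))"
    by (simp add: L2_inner_partial_sum sq' square_integrable_shift Zsq)
  also have "\<dots> = (\<Sum>u=1..int n. \<Sum>v=1..int (m - q). c (u - int p) v)"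
    using pq c0 by (intro sum.cong refl sum_shift_int) auto
  also have "\<dots> = (\<Sum>u=1..int (n - p). \<Sum>v=1..int (m - q). c u v)"
    using pq c0 by (intro sum_shift_int) auto
  also have "\<dots> = L2_inner P (partial_sum (field_of g) (n - p) (m - q)) Z"
    unfolding c_def by (intro L2_inner_partial_sum[symmetric] sq' Zsq)
  finally show ?thesis .
qed

text \<open>Offsets start at 0 because \<open>Z\<close> is thought of as sitting at (1, 1), so its
  shifts occupy the rectangle over which \<open>partial_sum\<close> runs.\<close>

definition msum :: "((int \<times> int \<Rightarrow> real) \<Rightarrow> real) \<Rightarrow> nat \<Rightarrow> nat \<Rightarrow> (int \<times> int \<Rightarrow> real) \<Rightarrow> real" where
  "msum Z n m x = (\<Sum>p<n. \<Sum>q<m. Z (shift (int p) (int q) x))"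

lemma partial_sum_field_of_eq_msum:
  "partial_sum (field_of d) n m = msum (field_of d 1 1) n m"
proof
  fix x
  have *: "(\<Sum>u=1..int k. h u) = (\<Sum>p<k. h (1 + int p))" for h :: "int \<Rightarrow> real" and k
    by (rule sum.reindex_bij_witness[where i = "\<lambda>p. 1 + int p" and j = "\<lambda>u. nat (u - 1)"]) auto
  show "partial_sum (field_of d) n m x = msum (field_of d 1 1) n m x"
    by (simp add: partial_sum_def msum_def * field_of_shift)
qed

lemma square_integrable_msum:
  assumes "square_integrable P Z"
  shows "square_integrable P (msum Z n m)"
  unfolding msum_def[abs_def] by (intro square_integrable_sum square_integrable_shift assms)

lemma L2_inner_msum_self:
  assumes "mdiff 1 1 Z"
  shows "L2_inner P (msum Z n m) (msum Z n m) = real n * real m * L2_inner P Z Z"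
proof -
  let ?I = "{..<n} \<times> {..<m}"
  let ?V = "\<lambda>i x. Z (shift (int (fst i)) (int (snd i)) x)"
  have Z: "square_integrable P Z" using assms by (rule mdiff_square_integrable)
  have "msum Z n m = (\<lambda>x. \<Sum>i\<in>?I. ?V i x)"
    by (rule HOL.ext) (simp add: msum_def sum.cartesian_product case_prod_unfold)
  moreover have "L2_inner P (\<lambda>x. \<Sum>i\<in>?I. ?V i x) (\<lambda>x. \<Sum>i\<in>?I. ?V i x)
      = (\<Sum>i\<in>?I. L2_inner P (?V i) (?V i))"
    by (rule mdiff_sum_orthogonal[where u = "\<lambda>i. 1 + int (fst i)" and v = "\<lambda>i. 1 + int (snd i)"])
      (auto simp: inj_on_def intro: mdiff_shift[OF assms])
  moreover have "\<dots> = (\<Sum>i\<in>?I. L2_inner P Z Z)"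
    by (simp only: L2_inner_shift[OF Z Z])
  ultimately show ?thesis by simp
qed

text \<open>The shift by (p, q) leaves the rectangle (n - p, m - q), and these run through all (j,
  k) with 1 <= j <= n and 1 <= k <= m. This is the source of the double average in the
  theorem.\<close>

lemma L2_inner_partial_sum_msum:
  assumes g: "g \<in> past_functionals" and sq: "square_integrable P (field_of g 0 0)"
    and Z: "mdiff 1 1 Z"
  shows "L2_inner P (partial_sum (field_of g) n m) (msum Z n m)
    = (\<Sum>j=1..n. \<Sum>k=1..m. L2_inner P (partial_sum (field_of g) j k) Z)"
proof -
  let ?S = "partial_sum (field_of g)"
  have S: "square_integrable P (?S j k)" for j k
    by (intro square_integrable_partial_sum square_integrable_field_of[OF sq])
  have Zs: "square_integrable P (\<lambda>x. Z (shift p q x))" for p q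
    by (intro square_integrable_shift mdiff_square_integrable[OF Z])
  have rev: "(\<Sum>p<k. h (k - p)) = (\<Sum>j=1..k. h j)" for h :: "nat \<Rightarrow> real" and k
    by (rule sum.reindex_bij_witness[where i = "\<lambda>j. k - j" and j = "\<lambda>p. k - p"]) auto
  have "L2_inner P (?S n m) (msum Z n m)
      = (\<Sum>p<n. \<Sum>q<m. L2_inner P (?S n m) (\<lambda>x. Z (shift (int p) (int q) x)))"
    unfolding msum_def[abs_def] using S Zs
    by (simp add: L2_inner_sum_right square_integrable_sum)
  also have "\<dots> = (\<Sum>p<n. \<Sum>q<m. L2_inner P (?S (n - p) (m - q)) Z)"
    by (intro sum.cong refl L2_inner_partial_sum_shift[OF g sq Z]) auto
  also have "\<dots> = (\<Sum>j=1..n. \<Sum>k=1..m. L2_inner P (?S j k) Z)"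
    using rev[of "\<lambda>j. \<Sum>q<m. L2_inner P (?S j (m - q)) Z" n]
    by (simp add: rev[of "\<lambda>k. L2_inner P (?S _ k) Z"])
  finally show ?thesis .
qed

end

section \<open>Commuting filtrations\<close>

locale commuting_measure = stationary_measure +
  assumes commuting: "commuting_filtration P"
begin

text \<open>Commutation is available when the outer conditioning has the smaller first index. If a
  <= u, \<open>Y\<close> is conditioned further on \<open>filtr a b\<close>; otherwise
  self-adjointness moves the conditioning to \<open>W\<close>, which equals
  \<open>E a b W\<close>.\<close>

lemma L2_inner_cond_exp_min:
  assumes Y: "square_integrable P Y" and W: "square_integrable P W"
    and Wm: "W \<in> borel_measurable (filtr a b)"
  shows "L2_inner P (E u v Y) W = L2_inner P (E (min u a) (min v b) Y) W"
proof (cases "a \<le> u")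
  case True
  have "L2_inner P (E u v Y) W = L2_inner P (E a b (E u v Y)) W"
    by (rule L2_inner_cond_exp_left[OF square_integrable_cond_exp[OF Y] W Wm, symmetric])
  also have "\<dots> = L2_inner P (E a (min v b) Y) W"
    using commuting True integrable_if_square_integrable[OF Y] square_integrable_measurable[OF W]
    unfolding commuting_filtration_def
    by (intro L2_inner_cong_AE borel_measurable_cond_exp2) auto
  finally show ?thesis using True by (simp add: min_absorb2)
next
  case False
  have "AE x in P. E u v W x = E u v (E a b W) x"
    using cond.real_cond_exp_F_meas[OF integrable_if_square_integrable[OF W] Wm]
      square_integrable_measurable[OF W]
    by (intro cond.real_cond_exp_cong borel_measurable_cond_exp2) auto
  moreover have "AE x in P. E u v (E a b W) x = E u (min v b) W x"
    using commuting False integrable_if_square_integrable[OF W]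
    unfolding commuting_filtration_def by (simp add: min.commute)
  ultimately have "AE x in P. E u v W x = E u (min v b) W x"
    by eventually_elim simp
  then have "L2_inner P Y (E u v W) = L2_inner P Y (E u (min v b) W)"
    using square_integrable_measurable[OF Y]
    by (intro L2_inner_cong_AE borel_measurable_cond_exp2) simp_all
  with False show ?thesis
    by (simp add: L2_inner_cond_exp_adjoint[OF Y W] min_absorb1)
qed

section \<open>The orthogonal projection onto the innovations\<close>

lemma square_integrable_proj_op:
  "square_integrable P Y \<Longrightarrow> square_integrable P (proj_op P u v Y)"
  unfolding proj_op_def[abs_def]
  by (intro square_integrable_add square_integrable_diff square_integrable_cond_exp)

lemma L2_inner_proj_op_expand:
  assumes "square_integrable P Y" "square_integrable P W"
  shows "L2_inner P (proj_op P u v Y) W = L2_inner P (E u v Y) W - L2_inner P (E u (v - 1) Y) W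
    - L2_inner P (E (u - 1) v Y) W + L2_inner P (E (u - 1) (v - 1) Y) W"
  unfolding proj_op_def[abs_def] using assms
  by (simp add: L2_inner_add_left L2_inner_diff_left square_integrable_diff square_integrable_cond_exp)

lemma mdiff_proj_op:
  assumes Y: "square_integrable P Y"
  shows "mdiff u v (proj_op P u v Y)"
  unfolding mdiff_def
proof (intro conjI allI impI)
  show "square_integrable P (proj_op P u v Y)"
    using Y by (rule square_integrable_proj_op)
  have "E a b Y \<in> borel_measurable (filtr u v)" if "a \<le> u" "b \<le> v" for a b
    using that by (rule measurable_filtr_mono) (rule borel_measurable_cond_exp)
  then show "proj_op P u v Y \<in> borel_measurable (filtr u v)"
    unfolding proj_op_def[abs_def] by (intro borel_measurable_add borel_measurable_diff) simp_all
  fix a b W assume ab: "a < u \<or> b < v" and W: "square_integrable P W" "W \<in> borel_measurable (filtr a b)"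
  \<comment> \<open>If a < u, lowering u by one does not change its minimum with a, so the four
    terms cancel in pairs with equal second index. If b < v they cancel in pairs with equal first
    index.\<close>
  have "min u a = min (u - 1) a \<or> min v b = min (v - 1) b"
    using ab by auto
  then show "L2_inner P (proj_op P u v Y) W = 0"
    unfolding L2_inner_proj_op_expand[OF Y W(1)]
    by (auto simp: L2_inner_cond_exp_min[OF Y W, of u v] L2_inner_cond_exp_min[OF Y W, of "u - 1" v]
        L2_inner_cond_exp_min[OF Y W, of u "v - 1"] L2_inner_cond_exp_min[OF Y W, of "u - 1" "v - 1"])
qed

text \<open>Three of the four conditional expectations live in earlier sigma-fields and are
  orthogonal to \<open>Z\<close>; in the remaining one the conditioning drops out because
  \<open>Z\<close> is measurable.\<close>

lemma L2_inner_proj_op_mdiff: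
  assumes Y: "square_integrable P Y" and Z: "mdiff u v Z"
  shows "L2_inner P (proj_op P u v Y) Z = L2_inner P Y Z"
proof -
  have Zsq: "square_integrable P Z" using Z by (rule mdiff_square_integrable)
  have 0: "L2_inner P (E a b Y) Z = 0" if "a < u \<or> b < v" for a b
    unfolding L2_inner_commute[of P _ Z]
    by (rule mdiff_orthogonal_past[OF Z that square_integrable_cond_exp[OF Y] borel_measurable_cond_exp])
  show ?thesis
    unfolding L2_inner_proj_op_expand[OF Y Zsq]
    by (simp add: 0 L2_inner_cond_exp_left[OF Y Zsq mdiff_measurable[OF Z]])
qed

lemma mdiff_average_proj_op:
  assumes "\<And>j k. square_integrable P (S j k)"
  shows "mdiff u v (\<lambda>x. c * (\<Sum>j\<in>J. \<Sum>k\<in>K. proj_op P u v (S j k) x))"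
  by (intro mdiff_scale mdiff_sum mdiff_proj_op assms)

lemma L2_inner_average_proj_op:
  assumes S: "\<And>j k. square_integrable P (S j k)" and Z: "mdiff u v Z"
  shows "L2_inner P (\<lambda>x. c * (\<Sum>j\<in>J. \<Sum>k\<in>K. proj_op P u v (S j k) x)) Z
    = c * (\<Sum>j\<in>J. \<Sum>k\<in>K. L2_inner P (S j k) Z)"
  using L2_inner_proj_op_mdiff[OF S Z] mdiff_square_integrable[OF Z]
  by (simp add: L2_inner_scale_left L2_inner_sum_left square_integrable_sum
      square_integrable_proj_op[OF S])

text \<open>With \<open>A\<close> the difference on the left, pairing \<open>S - M\<close> with the sum of the shifts of
  \<open>A\<close> gives \<open>n m \<parallel>A\<parallel>\<^sup>2\<close>, and the claim is the Cauchy--Schwarz inequality.\<close>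

lemma norm_average_proj_op_diff_le:
  assumes f: "f \<in> past_functionals" and sqf: "square_integrable P (field_of f 0 0)"
    and d: "d \<in> past_functionals" and sqd: "square_integrable P (field_of d 0 0)"
    and md: "mdiff 1 1 (field_of d 1 1)" and nm: "n \<ge> 1" "m \<ge> 1"
    and A_def: "A = (\<lambda>x. 1 / (real n * real m) * (\<Sum>j=1..n. \<Sum>k=1..m.
      proj_op P 1 1 (partial_sum (field_of f) j k) x) - field_of d 1 1 x)"
    and R_def: "R = partial_sum (field_of (\<lambda>y. f y - d y)) n m"
  shows "L2_inner P A A \<le> L2_inner P R R / (real n * real m)"
proof -
  let ?S = "partial_sum (field_of f)" and ?M = "partial_sum (field_of d)" and ?c = "real n * real m"
  let ?R = "partial_sum (field_of (\<lambda>y. f y - d y))" and ?D = "field_of d 1 1"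
  have c: "?c > 0" using nm by simp
  have S: "square_integrable P (?S j k)" and M: "square_integrable P (?M j k)" for j k
    by (intro square_integrable_partial_sum square_integrable_field_of[OF sqf]
        square_integrable_field_of[OF sqd])+
  \<comment> \<open>The difference of the two fields is again generated by one functional, so the
    pairing formula applies to it directly.\<close>
  have fd: "(\<lambda>y. f y - d y) \<in> past_functionals"
    using f d unfolding past_functionals_def by (rule borel_measurable_diff)
  have sqr: "square_integrable P (field_of (\<lambda>y. f y - d y) 0 0)"
    unfolding field_of_diff[abs_def] using sqf sqd by (rule square_integrable_diff)
  have A: "mdiff 1 1 A"
    unfolding A_def by (intro mdiff_diff mdiff_average_proj_op S md)
  have Asq: "square_integrable P A" using A by (rule mdiff_square_integrable)
  \<comment> \<open>Each sum with j, k >= 1 contains the (1, 1) term exactly once, and every other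
    term is orthogonal to \<open>A\<close>; hence all n m pairings agree.\<close>
  have Msum: "(\<Sum>j=1..n. \<Sum>k=1..m. L2_inner P (?M j k) A) = ?c * L2_inner P ?D A"
  proof -
    have "L2_inner P (?M j k) A = L2_inner P ?D A" if "j \<in> {1..n}" "k \<in> {1..m}" for j k
    proof -
      have *: "L2_inner P (field_of d u v) A = 0" if "(u, v) \<noteq> (1, 1)" "u \<ge> 1" "v \<ge> 1" for u v
        using mdiff_orthogonal[OF mdiff_shift[OF md, of "u - 1" "v - 1"] A] that
        by (simp add: field_of_shift)
      have "L2_inner P (?M j k) A = (\<Sum>u=1..int j. \<Sum>v=1..int k. L2_inner P (field_of d u v) A)"
        by (intro L2_inner_partial_sum square_integrable_field_of[OF sqd] Asq)
      also have "\<dots> = (\<Sum>u=1..int j. \<Sum>v=1..int k. if v = 1 then if u = 1 then L2_inner P ?D A else 0 else 0)"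
        using * by (intro sum.cong refl) auto
      also have "\<dots> = L2_inner P ?D A" using that by simp
      finally show ?thesis .
    qed
    then show ?thesis by simp
  qed
  have R_eq: "L2_inner P (?R j k) A = L2_inner P (?S j k) A - L2_inner P (?M j k) A" for j k
  proof -
    have "?R j k = (\<lambda>x. ?S j k x - ?M j k x)"
      by (rule HOL.ext) (simp add: partial_sum_def field_of_diff sum_subtractf)
    then show ?thesis by (simp add: L2_inner_diff_left S M Asq)
  qed
  have "L2_inner P R (msum A n m) = (\<Sum>j=1..n. \<Sum>k=1..m. L2_inner P (?R j k) A)"
    unfolding R_def by (rule L2_inner_partial_sum_msum[OF fd sqr A])
  also have "\<dots> = (\<Sum>j=1..n. \<Sum>k=1..m. L2_inner P (?S j k) A) - ?c * L2_inner P ?D A"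
    unfolding R_eq sum_subtractf Msum ..
  also have "\<dots> = ?c * (1 / ?c * (\<Sum>j=1..n. \<Sum>k=1..m. L2_inner P (?S j k) A) - L2_inner P ?D A)"
    using c by (simp only: right_diff_distrib) simp
  also have "\<dots> = ?c * L2_inner P A A"
  proof -
    have "L2_inner P A A = L2_inner P (\<lambda>x. 1 / ?c * (\<Sum>j=1..n. \<Sum>k=1..m. proj_op P 1 1 (?S j k) x)) A
        - L2_inner P ?D A"
      unfolding A_def
      by (rule L2_inner_diff_left)
        (intro mdiff_square_integrable[OF mdiff_average_proj_op] mdiff_square_integrable[OF md]
          Asq[unfolded A_def] S)+
    then show ?thesis
      unfolding L2_inner_average_proj_op[OF S A] by simp
  qed
  finally have sq_le: "(?c * L2_inner P A A)\<^sup>2 \<le> L2_inner P R R * (?c * L2_inner P A A)"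
    using L2_Cauchy_Schwarz[of P R "msum A n m"] L2_inner_msum_self[OF A, of n m]
      square_integrable_msum[OF Asq] square_integrable_partial_sum[of "field_of (\<lambda>y. f y - d y)"]
      square_integrable_field_of[OF sqr]
    by (simp add: R_def)
  \<comment> \<open>Cancel one factor \<open>?c * L2_inner P A A\<close> from the Cauchy-Schwarz
    bound when it is positive.\<close>
  have "?c * L2_inner P A A \<le> L2_inner P R R"
  proof (cases "L2_inner P A A = 0")
    case False
    then have "?c * L2_inner P A A > 0"
      using c L2_inner_nonneg[of P A] by (intro mult_pos_pos[OF c]) simp
    then show ?thesis
      by (rule mult_right_le_imp_le[rotated])
        (use sq_le in \<open>simp only: power2_eq_square\<close>)
  qed (simp add: L2_inner_nonneg)
  with c show ?thesis by (simp add: pos_le_divide_eq mult.commute)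
qed

lemma norm_diff_msum:
  assumes f: "f \<in> past_functionals" and sqf: "square_integrable P (field_of f 0 0)"
    and D: "square_integrable P D" and nm: "n \<ge> 1" "m \<ge> 1"
    and A_def: "A = (\<lambda>x. 1 / (real n * real m) * (\<Sum>j=1..n. \<Sum>k=1..m.
      proj_op P 1 1 (partial_sum (field_of f) j k) x))"
    and S_def: "S = partial_sum (field_of f) n m" and M_def: "M = msum (proj_op P 1 1 D) n m"
  shows "L2_inner P (\<lambda>x. S x - M x) (\<lambda>x. S x - M x) / (real n * real m)
    = L2_inner P S S / (real n * real m) - 2 * L2_inner P A D
      + L2_inner P (proj_op P 1 1 D) (proj_op P 1 1 D)"
proof -
  let ?c = "real n * real m" and ?Z = "proj_op P 1 1 D"
  have c: "?c > 0" using nm by simp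
  have Z: "mdiff 1 1 ?Z" using D by (rule mdiff_proj_op)
  have Ssq: "square_integrable P (partial_sum (field_of f) j k)" for j k
    by (intro square_integrable_partial_sum square_integrable_field_of[OF sqf])
  have A: "mdiff 1 1 A" unfolding A_def by (intro mdiff_average_proj_op Ssq)
  \<comment> \<open>Since \<open>A\<close> is an innovation, \<open>D\<close> may be replaced by its
    projection, although \<open>D\<close> itself need not be measurable for
    \<open>filtr 1 1\<close>.\<close>
  have "L2_inner P A D = L2_inner P ?Z A"
    unfolding L2_inner_commute[of P A] by (rule L2_inner_proj_op_mdiff[OF D A, symmetric])
  also have "\<dots> = L2_inner P A ?Z" by (rule L2_inner_commute)
  also have "\<dots> = 1 / ?c * L2_inner P S M"
    unfolding A_def S_def M_def L2_inner_average_proj_op[OF Ssq Z]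
      L2_inner_partial_sum_msum[OF f sqf Z] ..
  finally have SM: "L2_inner P S M = ?c * L2_inner P A D" using nm by simp
  have "L2_inner P (\<lambda>x. S x - M x) (\<lambda>x. S x - M x)
      = L2_inner P S S - 2 * L2_inner P S M + L2_inner P M M"
    unfolding S_def M_def
    by (intro L2_inner_diff_self Ssq square_integrable_msum mdiff_square_integrable[OF Z])
  also have "L2_inner P M M = ?c * L2_inner P ?Z ?Z"
    unfolding M_def by (rule L2_inner_msum_self[OF Z])
  finally show ?thesis unfolding SM using nm by (simp add: field_simps)
qed

text \<open>Pairing \<open>Y\<close> with its projection gives the squared norm of the projection,
  so the squared norm of the difference is the difference of the squared norms.\<close>

lemma norm_proj_op_le:
  assumes "square_integrable P Y"
  shows "L2_inner P (proj_op P u v Y) (proj_op P u v Y) \<le> L2_inner P Y Y"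
proof -
  let ?Z = "proj_op P u v Y"
  have Z: "mdiff u v ?Z" using assms by (rule mdiff_proj_op)
  have "0 \<le> L2_inner P Y Y - 2 * L2_inner P Y ?Z + L2_inner P ?Z ?Z"
    using L2_inner_nonneg L2_inner_diff_self[OF assms mdiff_square_integrable[OF Z]] by metis
  with L2_inner_proj_op_mdiff[OF assms Z] show ?thesis by simp
qed

end

section \<open>Martingale approximation\<close>

lemma eventually_min_at_top:
  "eventually Q min_at_top \<longleftrightarrow> (\<exists>N. \<forall>n m. n \<ge> N \<longrightarrow> m \<ge> N \<longrightarrow> Q (n, m))"
  unfolding min_at_top_def eventually_filtercomap_at_top_linorder by auto

lemma eventually_min_at_top_pos: "eventually (\<lambda>(n, m). n \<ge> 1 \<and> m \<ge> 1) min_at_top"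
  unfolding eventually_min_at_top by (intro exI[of _ 1]) auto

text \<open>This passes from extended to real values. When n or m is 0 both sides are 0, division by
  zero being 0.\<close>

lemma scaled_l2_norm_sq_eq:
  assumes "square_integrable M f"
  shows "ennreal (1 / (real n * real m)) * l2_norm_sq M f
    = ennreal (L2_inner M f f / (real n * real m))"
  using assms
  by (simp add: l2_norm_sq_eq L2_inner_nonneg flip: ennreal_mult)

context commuting_measure
begin

lemma mdiff_of_martingale_differences_field:
  assumes "martingale_differences_field P D" "square_integrable P (D u v)"
  shows "mdiff u v (D u v)"
proof (rule mdiffI_cond_exp)
  from assms(1) obtain d where "d \<in> past_functionals" "D = field_of d"
    by (auto simp: martingale_differences_field_def)
  then show "D u v \<in> borel_measurable (filtr u v)"
    by (simp add: measurable_field_of)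
  show "AE x in P. E a b (D u v) x = 0" if "a < u \<or> b < v" for a b
    using assms(1) that unfolding martingale_differences_field_def by blast
qed (rule assms)

lemma martingale_differences_field_of_mdiff:
  assumes d: "d \<in> past_functionals" and Z: "mdiff 1 1 (field_of d 1 1)"
  shows "martingale_differences_field P (field_of d)"
proof -
  have *: "mdiff n m (field_of d n m)" for n m
    using mdiff_shift[OF Z, of "n - 1" "m - 1"] by (simp add: field_of_shift)
  show ?thesis
    unfolding martingale_differences_field_def
  proof (intro conjI allI impI)
    show "\<exists>e\<in>past_functionals. field_of d = field_of e" using d by blast
    show "integrable P (field_of d n m)" for n m
      by (rule integrable_if_square_integrable[OF mdiff_square_integrable[OF *]])
    show "AE x in P. E a b (field_of d n m) x = 0" if "a < n \<or> b < m" for a b n m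
      by (rule cond_exp_eq_0_if_mdiff[OF * that])
  qed
qed

text \<open>Martingale differences are only assumed integrable. The limit makes the error norm
  finite for large n and m, so those martingale sums are square integrable, and four of them isolate
  a single difference.\<close>

lemma square_integrable_of_martingale_approximation:
  assumes f: "f \<in> past_functionals" and sqf: "square_integrable P (field_of f 0 0)"
    and d: "d \<in> past_functionals"
    and lim: "((\<lambda>(n, m). ennreal (1 / (real n * real m)) * l2_norm_sq P (\<lambda>x.
      partial_sum (field_of f) n m x - partial_sum (field_of d) n m x)) \<longlongrightarrow> 0) min_at_top"
  shows "square_integrable P (field_of d 0 0)"
proof -
  let ?S = "partial_sum (field_of f)" and ?M = "partial_sum (field_of d)"
  have S: "square_integrable P (?S j k)" for j k
    by (intro square_integrable_partial_sum square_integrable_field_of[OF sqf])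
  have meas: "?M n m \<in> borel_measurable P" for n m
    unfolding partial_sum_def[abs_def]
    by (intro borel_measurable_sum borel_measurable_filtr_P[OF measurable_field_of[OF d]])
  have "eventually (\<lambda>z. (case z of (n, m) \<Rightarrow> ennreal (1 / (real n * real m)) * l2_norm_sq P (\<lambda>x.
      ?S n m x - ?M n m x)) < 1) min_at_top"
    using lim by (rule order_tendstoD) simp
  then obtain N0 where N0: "\<And>n m. n \<ge> N0 \<Longrightarrow> m \<ge> N0 \<Longrightarrow>
      ennreal (1 / (real n * real m)) * l2_norm_sq P (\<lambda>x. ?S n m x - ?M n m x) < 1"
    unfolding eventually_min_at_top by auto
  \<comment> \<open>With N >= 1 the factor 1 / (n m) is positive, so an infinite norm would give an
    infinite product, contradicting the bound by 1.\<close>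
  define N where "N = max N0 1"
  have M: "square_integrable P (?M n m)" if nm: "n \<ge> N" "m \<ge> N" for n m
  proof -
    have "l2_norm_sq P (\<lambda>x. ?S n m x - ?M n m x) \<noteq> \<infinity>"
    proof
      assume inf: "l2_norm_sq P (\<lambda>x. ?S n m x - ?M n m x) = \<infinity>"
      have "ennreal (1 / (real n * real m)) * \<infinity> = \<infinity>"
        using nm by (simp add: ennreal_mult_top N_def)
      with N0[of n m] nm inf show False by (simp add: N_def)
    qed
    then have "square_integrable P (\<lambda>x. ?S n m x - ?M n m x)"
      using square_integrable_measurable[OF S] meas
      by (intro square_integrable_if_l2_norm_sq_finite borel_measurable_diff)
        (simp_all add: less_top)
    from square_integrable_diff[OF S[of n m] this] show ?thesis by simp
  qed
  have *: "(\<Sum>u=1..int (Suc k). h u) = (\<Sum>u=1..int k. h u) + h (int (Suc k))" for h :: "int \<Rightarrow> real" and k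
  proof -
    have "{1..int (Suc k)} = insert (int (Suc k)) {1..int k}" by auto
    then show ?thesis by simp
  qed
  \<comment> \<open>Inclusion-exclusion over four rectangles leaves only the corner term.\<close>
  have "field_of d (int (Suc N)) (int (Suc N))
      = (\<lambda>x. (?M (Suc N) (Suc N) x - ?M N (Suc N) x) - (?M (Suc N) N x - ?M N N x))"
    by (rule HOL.ext, unfold partial_sum_def * sum.distrib) simp
  then have "square_integrable P (field_of d (int (Suc N)) (int (Suc N)))"
    by (simp only:) (intro square_integrable_diff M, simp_all)
  then show ?thesis by (rule square_integrable_field_of)
qed

text \<open>The witness is the (1, 1) member of the approximating field. Both limits are controlled
  by the scaled squared error \<rho>.\<close>

lemma martingale_approximation_imp_projection_limits:
  assumes f: "f \<in> past_functionals" and sqf: "square_integrable P (field_of f 0 0)"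
    and "admits_martingale_approximation P (field_of f)"
  shows "\<exists>D. square_integrable P D \<and>
    ((\<lambda>(n, m). l2_norm_sq P (\<lambda>x. 1 / (real n * real m) * (\<Sum>j=1..n. \<Sum>k=1..m.
        proj_op P 1 1 (partial_sum (field_of f) j k) x) - D x)) \<longlongrightarrow> 0) min_at_top \<and>
    ((\<lambda>(n, m). ennreal (1 / (real n * real m)) * l2_norm_sq P (partial_sum (field_of f) n m))
        \<longlongrightarrow> l2_norm_sq P D) min_at_top"
proof -
  let ?S = "partial_sum (field_of f)"
  from assms(3) obtain d where d: "d \<in> past_functionals"
    and mdf: "martingale_differences_field P (field_of d)"
    and lim: "((\<lambda>(n, m). ennreal (1 / (real n * real m)) * l2_norm_sq P (\<lambda>x.
      ?S n m x - partial_sum (field_of d) n m x)) \<longlongrightarrow> 0) min_at_top"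
    unfolding admits_martingale_approximation_def martingale_differences_field_def by blast
  let ?M = "partial_sum (field_of d)" and ?D = "field_of d 1 1"
  let ?R = "partial_sum (field_of (\<lambda>y. f y - d y))"
  define \<rho> where "\<rho> = (\<lambda>(n, m). L2_inner P (?R n m) (?R n m) / (real n * real m))"
  have sqd: "square_integrable P (field_of d 0 0)"
    by (rule square_integrable_of_martingale_approximation[OF f sqf d lim])
  then have D: "square_integrable P ?D" by (rule square_integrable_field_of)
  have md: "mdiff 1 1 ?D"
    by (rule mdiff_of_martingale_differences_field[OF mdf D])
  have S: "square_integrable P (?S j k)" and M: "square_integrable P (?M j k)" for j k
    by (intro square_integrable_partial_sum square_integrable_field_of[OF sqf]
        square_integrable_field_of[OF sqd])+
  have R_eq: "?R n m = (\<lambda>x. ?S n m x - ?M n m x)" for n m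
    by (rule HOL.ext) (simp add: partial_sum_def field_of_diff sum_subtractf)
  have R: "square_integrable P (?R n m)" for n m
    unfolding R_eq by (intro square_integrable_diff S M)
  have \<rho>_nonneg: "\<rho> z \<ge> 0" for z
    by (cases z) (simp add: \<rho>_def L2_inner_nonneg)
  have \<rho>_ennreal: "((\<lambda>z. ennreal (\<rho> z)) \<longlongrightarrow> ennreal 0) min_at_top"
    using lim by (simp add: \<rho>_def case_prod_unfold scaled_l2_norm_sq_eq[OF R] flip: R_eq)
  then have \<rho>: "(\<rho> \<longlongrightarrow> 0) min_at_top"
    using \<rho>_nonneg by (subst (asm) tendsto_ennreal_iff) auto
  have avg: "((\<lambda>(n, m). l2_norm_sq P (\<lambda>x. 1 / (real n * real m) * (\<Sum>j=1..n. \<Sum>k=1..m.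
        proj_op P 1 1 (?S j k) x) - ?D x)) \<longlongrightarrow> 0) min_at_top"
  proof (rule tendsto_sandwich[of "\<lambda>_. 0"])
    show "((\<lambda>z. ennreal (\<rho> z)) \<longlongrightarrow> 0) min_at_top"
      using \<rho>_ennreal by simp
    show "eventually (\<lambda>z. (case z of (n, m) \<Rightarrow> l2_norm_sq P (\<lambda>x. 1 / (real n * real m) *
        (\<Sum>j=1..n. \<Sum>k=1..m. proj_op P 1 1 (?S j k) x) - ?D x)) \<le> ennreal (\<rho> z)) min_at_top"
      using eventually_min_at_top_pos
    proof eventually_elim
      case (elim z)
      obtain n m where z: "z = (n, m)" by (cases z)
      let ?A = "\<lambda>x. 1 / (real n * real m) * (\<Sum>j=1..n. \<Sum>k=1..m. proj_op P 1 1 (?S j k) x) - ?D x"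
      have "mdiff 1 1 ?A"
        by (intro mdiff_diff mdiff_average_proj_op S md)
      moreover have "L2_inner P ?A ?A \<le> \<rho> z"
        using norm_average_proj_op_diff_le[OF f sqf d sqd md _ _ refl refl, of n m] elim
        by (simp only: \<rho>_def z prod.case)
      ultimately show ?case
        by (simp only: z prod.case l2_norm_sq_eq[OF mdiff_square_integrable] ennreal_leI)
    qed
  qed simp_all
  define \<sigma> where "\<sigma> = (\<lambda>(n, m). L2_inner P (?S n m) (?S n m) / (real n * real m))"
  have "((\<lambda>z. \<sigma> z - L2_inner P ?D ?D) \<longlongrightarrow> 0) min_at_top"
  proof (rule tendsto_rabs_zero_cancel, rule tendsto_sandwich[of "\<lambda>_. 0"])
    \<comment> \<open>Expanding the square of S = R + M, the excess over the norm of the witness is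
      \<rho> plus twice a cross term; Cauchy-Schwarz bounds the latter by the square root.\<close>
    show "((\<lambda>z. 2 * sqrt (L2_inner P ?D ?D * \<rho> z) + \<rho> z) \<longlongrightarrow> 0) min_at_top"
      using \<rho> by (auto intro!: tendsto_eq_intros)
    show "eventually (\<lambda>z. \<bar>\<sigma> z - L2_inner P ?D ?D\<bar> \<le> 2 * sqrt (L2_inner P ?D ?D * \<rho> z) + \<rho> z) min_at_top"
      using eventually_min_at_top_pos
    proof eventually_elim
      case (elim z)
      obtain n m where z: "z = (n, m)" by (cases z)
      let ?c = "real n * real m"
      have c: "?c > 0" using elim z by simp
      have MM: "L2_inner P (?M n m) (?M n m) = ?c * L2_inner P ?D ?D"
        unfolding partial_sum_field_of_eq_msum by (rule L2_inner_msum_self[OF md])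
      have RR: "L2_inner P (?R n m) (?R n m) = ?c * \<rho> z" using elim by (simp add: \<rho>_def z)
      \<comment> \<open>The sum R + M is written as a difference so that
        \<open>L2_inner_diff_self\<close> applies.\<close>
      have "?S n m = (\<lambda>x. ?R n m x - (-1) * ?M n m x)" by (simp add: R_eq)
      then have "L2_inner P (?S n m) (?S n m) = L2_inner P (?R n m) (?R n m)
          + 2 * L2_inner P (?R n m) (?M n m) + L2_inner P (?M n m) (?M n m)"
        using L2_inner_diff_self[OF R square_integrable_scale[OF M], of n m "-1" n m]
        by (simp only: L2_inner_scale_left L2_inner_scale_right)
      then have \<sigma>: "\<sigma> z - L2_inner P ?D ?D = \<rho> z + 2 * (L2_inner P (?R n m) (?M n m) / ?c)"
        using elim by (simp add: \<sigma>_def z MM RR field_simps)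
      have "(L2_inner P (?R n m) (?M n m))\<^sup>2 \<le> (?c * \<rho> z) * (?c * L2_inner P ?D ?D)"
        using L2_Cauchy_Schwarz[OF R M, of n m n m] by (simp only: MM RR)
      then have "(L2_inner P (?R n m) (?M n m) / ?c)\<^sup>2 \<le> L2_inner P ?D ?D * \<rho> z"
        unfolding power_divide pos_divide_le_eq[OF zero_less_power[OF c]]
        by (simp add: power2_eq_square ac_simps)
      then have "\<bar>L2_inner P (?R n m) (?M n m) / ?c\<bar> \<le> sqrt (L2_inner P ?D ?D * \<rho> z)"
        by (rule real_le_rsqrt[of "\<bar>_\<bar>", simplified])
      with \<sigma> \<rho>_nonneg[of z] show ?case by linarith
    qed
  qed simp_all
  then have "(\<sigma> \<longlongrightarrow> L2_inner P ?D ?D) min_at_top"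
    by (rule LIM_zero_cancel)
  then have "((\<lambda>(n, m). ennreal (1 / (real n * real m)) * l2_norm_sq P (?S n m))
        \<longlongrightarrow> l2_norm_sq P ?D) min_at_top"
    unfolding scaled_l2_norm_sq_eq[OF S] l2_norm_sq_eq[OF D]
    using tendsto_ennrealI[of \<sigma>] by (simp add: \<sigma>_def case_prod_unfold)
  with D avg show ?thesis by blast
qed

lemma projection_limits_imp_martingale_approximation:
  assumes f: "f \<in> past_functionals" and sqf: "square_integrable P (field_of f 0 0)"
    and D: "square_integrable P D"
    and lim1: "((\<lambda>(n, m). l2_norm_sq P (\<lambda>x. 1 / (real n * real m) * (\<Sum>j=1..n. \<Sum>k=1..m.
        proj_op P 1 1 (partial_sum (field_of f) j k) x) - D x)) \<longlongrightarrow> 0) min_at_top"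
    and lim2: "((\<lambda>(n, m). ennreal (1 / (real n * real m)) * l2_norm_sq P (partial_sum (field_of f) n m))
        \<longlongrightarrow> l2_norm_sq P D) min_at_top"
  shows "admits_martingale_approximation P (field_of f)"
proof -
  let ?S = "partial_sum (field_of f)" and ?Z = "proj_op P 1 1 D"
  have S: "square_integrable P (?S j k)" for j k
    by (intro square_integrable_partial_sum square_integrable_field_of[OF sqf])
  have Z: "mdiff 1 1 ?Z" using D by (rule mdiff_proj_op)
  \<comment> \<open>The projection of \<open>D\<close> is measurable for \<open>filtr 1 1\<close>,
    hence is the (1, 1) member of a field; this field is the approximating one.\<close>
  obtain d where d: "d \<in> past_functionals" and dZ: "field_of d 1 1 = ?Z"
    using measurable_filtr_eq_field_of[OF mdiff_measurable[OF Z]] .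
  let ?M = "partial_sum (field_of d)"
  have M_eq: "?M n m = msum ?Z n m" for n m
    unfolding partial_sum_field_of_eq_msum dZ ..
  have M: "square_integrable P (?M n m)" for n m
    unfolding M_eq by (rule square_integrable_msum[OF mdiff_square_integrable[OF Z]])
  define A where "A = (\<lambda>(n, m) x. 1 / (real n * real m) * (\<Sum>j=1..n. \<Sum>k=1..m. proj_op P 1 1 (?S j k) x))"
  have A: "square_integrable P (A z)" for z
    by (cases z) (simp only: A_def prod.case mdiff_square_integrable[OF mdiff_average_proj_op[OF S]])
  define \<alpha> where "\<alpha> z = L2_inner P (\<lambda>x. A z x - D x) (\<lambda>x. A z x - D x)" for z
  define \<sigma> where "\<sigma> = (\<lambda>(n, m). L2_inner P (?S n m) (?S n m) / (real n * real m))"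
  have \<alpha>_nonneg: "\<alpha> z \<ge> 0" for z by (simp add: \<alpha>_def L2_inner_nonneg)
  have "((\<lambda>z. l2_norm_sq P (\<lambda>x. A z x - D x)) \<longlongrightarrow> 0) min_at_top"
    using lim1 by (simp only: A_def case_prod_unfold)
  then have "((\<lambda>z. ennreal (\<alpha> z)) \<longlongrightarrow> ennreal 0) min_at_top"
    by (simp add: \<alpha>_def l2_norm_sq_eq[OF square_integrable_diff[OF A D]])
  then have \<alpha>: "(\<alpha> \<longlongrightarrow> 0) min_at_top"
    using \<alpha>_nonneg by (subst (asm) tendsto_ennreal_iff) auto
  have "((\<lambda>z. ennreal (\<sigma> z)) \<longlongrightarrow> ennreal (L2_inner P D D)) min_at_top"
    using lim2 by (simp add: \<sigma>_def case_prod_unfold scaled_l2_norm_sq_eq[OF S] l2_norm_sq_eq[OF D])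
  then have \<sigma>: "(\<sigma> \<longlongrightarrow> L2_inner P D D) min_at_top"
    by (subst (asm) tendsto_ennreal_iff) (auto simp: \<sigma>_def case_prod_unfold L2_inner_nonneg)
  have "((\<lambda>z. L2_inner P (\<lambda>x. A z x - D x) D) \<longlongrightarrow> 0) min_at_top"
  proof (rule tendsto_rabs_zero_cancel, rule tendsto_sandwich[of "\<lambda>_. 0"])
    show "((\<lambda>z. sqrt (\<alpha> z * L2_inner P D D)) \<longlongrightarrow> 0) min_at_top"
      using \<alpha> by (auto intro!: tendsto_eq_intros)
    have "\<bar>L2_inner P (\<lambda>x. A z x - D x) D\<bar> \<le> sqrt (\<alpha> z * L2_inner P D D)" for z
      using L2_Cauchy_Schwarz[OF square_integrable_diff[OF A D] D, of z]
      by (intro real_le_rsqrt) (simp add: \<alpha>_def)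
    then show "eventually (\<lambda>z. \<bar>L2_inner P (\<lambda>x. A z x - D x) D\<bar> \<le> sqrt (\<alpha> z * L2_inner P D D)) min_at_top"
      by simp
  qed simp_all
  then have AD: "((\<lambda>z. L2_inner P (A z) D - L2_inner P D D) \<longlongrightarrow> 0) min_at_top"
    by (simp add: L2_inner_diff_left[OF A D D])
  define \<delta> where "\<delta> = (\<lambda>(n, m). L2_inner P (\<lambda>x. ?S n m x - ?M n m x) (\<lambda>x. ?S n m x - ?M n m x) / (real n * real m))"
  have "(\<delta> \<longlongrightarrow> 0) min_at_top"
  proof (rule tendsto_sandwich[of "\<lambda>_. 0"])
    \<comment> \<open>The bound is the expansion of \<delta> with the squared norm of the projection
      replaced by the larger one of \<open>D\<close>, regrouped into two differences that tend to
      0.\<close>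
    have "((\<lambda>z. (\<sigma> z - L2_inner P D D) - 2 * (L2_inner P (A z) D - L2_inner P D D)) \<longlongrightarrow> 0 - 2 * 0) min_at_top"
      using \<sigma> by (intro tendsto_diff tendsto_mult tendsto_const AD) (simp add: LIM_zero)
    then show "((\<lambda>z. (\<sigma> z - L2_inner P D D) - 2 * (L2_inner P (A z) D - L2_inner P D D)) \<longlongrightarrow> 0) min_at_top"
      by simp
    show "eventually (\<lambda>z. \<delta> z \<le> (\<sigma> z - L2_inner P D D) - 2 * (L2_inner P (A z) D - L2_inner P D D)) min_at_top"
      using eventually_min_at_top_pos
    proof eventually_elim
      case (elim z)
      obtain n m where z: "z = (n, m)" by (cases z)
      have "\<delta> z = \<sigma> z - 2 * L2_inner P (A z) D + L2_inner P ?Z ?Z"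
        unfolding z \<delta>_def \<sigma>_def A_def prod.case M_eq
        by (rule norm_diff_msum[OF f sqf D _ _ refl refl refl]) (use elim z in auto)
      with norm_proj_op_le[OF D, of 1 1] show ?case by simp
    qed
    show "eventually (\<lambda>z. 0 \<le> \<delta> z) min_at_top"
      by (simp add: \<delta>_def case_prod_unfold L2_inner_nonneg)
  qed simp
  then have "((\<lambda>z. ennreal (\<delta> z)) \<longlongrightarrow> 0) min_at_top"
    using tendsto_ennrealI[of \<delta> 0] by simp
  then have "((\<lambda>(n, m). ennreal (1 / (real n * real m)) * l2_norm_sq P (\<lambda>x. ?S n m x - ?M n m x)) \<longlongrightarrow> 0) min_at_top"
    by (simp add: scaled_l2_norm_sq_eq[OF square_integrable_diff[OF S M]] \<delta>_def case_prod_unfold)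
  moreover have "martingale_differences_field P (field_of d)"
    using Z by (intro martingale_differences_field_of_mdiff d) (simp add: dZ)
  ultimately show ?thesis
    unfolding admits_martingale_approximation_def by blast
qed

end


theorem theorem5:
  fixes P :: "(int \<times> int \<Rightarrow> real) measure"
    and f :: "(int \<times> int \<Rightarrow> real) \<Rightarrow> real"
    and X :: "int \<Rightarrow> int \<Rightarrow> (int \<times> int \<Rightarrow> real) \<Rightarrow> real"
    and S :: "nat \<Rightarrow> nat \<Rightarrow> (int \<times> int \<Rightarrow> real) \<Rightarrow> real"
  assumes "stationary_law P"
    and "f \<in> past_functionals"
    and "X = field_of f"
    and "square_integrable P (X 0 0)"
    and "integral\<^sup>L P (X 0 0) = 0"
    and "commuting_filtration P"
    and "S = partial_sum X"
  shows "admits_martingale_approximation P X \<longleftrightarrow>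
    (\<exists>D. square_integrable P D \<and>
       ((\<lambda>(n, m). l2_norm_sq P (\<lambda>x.
            1 / (real n * real m) * (\<Sum>j = 1..n. \<Sum>k = 1..m. proj_op P 1 1 (S j k) x) - D x))
        \<longlongrightarrow> 0) min_at_top \<and>
       ((\<lambda>(n, m). ennreal (1 / (real n * real m)) * l2_norm_sq P (S n m))
        \<longlongrightarrow> l2_norm_sq P D) min_at_top)"
proof -
  interpret commuting_measure P
    using assms(1,6) by unfold_locales
  have sqf: "square_integrable P (field_of f 0 0)"
    using assms(3,4) by simp
  show ?thesis
    unfolding assms(3,7)
    using martingale_approximation_imp_projection_limits[OF assms(2) sqf]
      projection_limits_imp_martingale_approximation[OF assms(2) sqf]
    by blast
qed

end
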